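(* For all integers $n\geq 1$ and $k\geq 0$, the number of permutations of $[n]$ with exactly $k$ exterior peaks equals the number of increasing trees on $[n]$ with exactly $2k+1$ vertices of even degree.
   Context: For a permutation $\pi=\pi_1\pi_2\cdots\pi_n$ of $[n]=\{1,\ldots,n\}$, an index $i$ is an exterior peak if either $1<i<n$ and $\pi_{i-1}<\pi_i>\pi_{i+1}$, or $i=1$ (with $n\geq 2$) and $\pi_1>\pi_2$. An increasing tree on $[n]$ is a rooted tree with vertex set $\{0,1,\ldots,n\}$, rooted at $0$, in which labels increase along every path starting from the root. The degree of a vertex is the number of its children; vertices of even degree include all leaves and may include the root $0$. *)

theory Defs
  imports
    Complex_Main
    "HOL-Combinatorics.Permutations"
    "Graph_Theory.Pair_Digraph"
begin

definition exterior_peaks :: "nat \<Rightarrow> (nat \<Rightarrow> nat) \<Rightarrow> nat set" where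
  "exterior_peaks n \<pi> =
     {i \<in> {1..n}. (1 < i \<and> i < n \<and> \<pi> (i - 1) < \<pi> i \<and> \<pi> i > \<pi> (i + 1)) \<or>
                  (i = 1 \<and> n \<ge> 2 \<and> \<pi> 1 > \<pi> 2)}"

text \<open>
  A rooted tree is represented by its arcs directed from parent to child. The constant
  \<open>tree\<close> of the session \<open>Graph_Theory\<close> is not suitable: it excludes only directed cycles,
  so it admits acyclic digraphs with vertices of in-degree two, and it rejects every
  symmetric digraph having an arc.
\<close>

definition rooted_tree :: "('a, 'b) pre_digraph \<Rightarrow> 'a \<Rightarrow> bool" where
  "rooted_tree G r \<longleftrightarrow>
     wf_digraph G \<and> r \<in> verts G \<and> (\<forall>v \<in> verts G. \<exists>!p. pre_digraph.awalk G r p v)"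

text \<open>
  Arcs are pairs of vertices, so that distinct values of \<open>T\<close> are distinct labelled
  (non-plane) trees; the children of a vertex carry no order.
\<close>

definition increasing_tree :: "nat \<Rightarrow> nat pair_pre_digraph \<Rightarrow> bool" where
  "increasing_tree n T \<longleftrightarrow>
     pverts T = {0..n} \<and> rooted_tree (with_proj T) 0 \<and>
     (\<forall>p v. pre_digraph.apath (with_proj T) 0 p v \<longrightarrow>
        sorted_wrt (<) (pre_digraph.awalk_verts (with_proj T) 0 p))"

text \<open>The degree of a vertex is its number of children, which is the out-degree here.\<close>

definition even_degree_vertices :: "nat pair_pre_digraph \<Rightarrow> nat set" where
  "even_degree_vertices T = {v \<in> pverts T. even (out_degree (with_proj T) v)}"

end

theory Submission
  imports Defs
begin

text \<open>
  Both sides satisfy the same recurrence. Attaching the new largest vertex of an increasing tree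
  to a vertex of even degree preserves the number \<open>m\<close> of even-degree vertices, and attaching it to
  a vertex of odd degree adds two. Likewise, let \<open>m\<close> be twice the number of exterior
  peaks plus one. Inserting the new largest letter of a permutation next to a peak or at the end
  preserves \<open>m\<close>, which accounts for \<open>m\<close> of the positions, and every other position creates a peak.
\<close>

section \<open>Counting by levels under an insertion bijection\<close>

text \<open>Every \<open>y\<close> in \<open>S'\<close> comes from exactly one pair
  \<open>(x, j)\<close>, so it suffices to count pairs for each \<open>x\<close>. An
  \<open>x\<close> at level \<open>m\<close> has \<open>m\<close> choices of \<open>j\<close> that
  stay there; an \<open>x\<close> at level \<open>m - 2\<close> reaches \<open>m\<close> by all but
  \<open>m - 2\<close> of its choices. Both recurrences are instances of this count.\<close>

lemma card_level_insertion:
  fixes E :: "'a \<Rightarrow> nat" and E' :: "'b \<Rightarrow> nat"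
  assumes fin: "finite S" "finite J"
    and bij: "bij_betw (\<lambda>(x, j). f x j) (S \<times> J) S'"
    and stay: "\<And>x. x \<in> S \<Longrightarrow> card {j \<in> J. E' (f x j) = E x} = E x"
    and step: "\<And>x j. x \<in> S \<Longrightarrow> j \<in> J \<Longrightarrow> E' (f x j) = E x \<or> E' (f x j) = E x + 2"
  shows "card {y \<in> S'. E' y = m} =
    m * card {x \<in> S. E x = m} + (card J + 2 - m) * card {x \<in> S. E x + 2 = m}"
proof -
  define g where "g = (\<lambda>(x, j). f x j)"
  have g: "inj_on g (S \<times> J)" "g ` (S \<times> J) = S'"
    using bij by (auto simp: bij_betw_def g_def)
  let ?D = "SIGMA x:S. {j \<in> J. E' (f x j) = m}"
  have "{y \<in> S'. E' y = m} = g ` ?D"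
    unfolding g(2)[symmetric] by (auto simp: g_def image_iff)
  moreover have "inj_on g ?D"
    by (rule inj_on_subset[OF g(1)]) auto
  ultimately have "card {y \<in> S'. E' y = m} = card ?D"
    by (simp add: card_image)
  also have "\<dots> = (\<Sum>x\<in>S. card {j \<in> J. E' (f x j) = m})"
    using fin by simp
  also have "\<dots> = (\<Sum>x\<in>S. (if E x = m then m else 0)
                       + (if E x + 2 = m then card J + 2 - m else 0))"
  proof (rule sum.cong[OF refl])
    fix x assume x: "x \<in> S"
    let ?K = "{j \<in> J. E' (f x j) = E x}"
    consider "E x = m" | "E x + 2 = m" | "E x \<noteq> m" "E x + 2 \<noteq> m" by blast
    then show "card {j \<in> J. E' (f x j) = m} =
      (if E x = m then m else 0) + (if E x + 2 = m then card J + 2 - m else 0)"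
    proof cases
      case 1
      then show ?thesis using stay[OF x] by simp
    next
      case 2
      \<comment> \<open>A choice that does not keep the level raises it by exactly two, which gives
        \<open>m\<close> here.\<close>
      have "{j \<in> J. E' (f x j) = m} = J - ?K"
        using step[OF x] 2 by fastforce
      then have "card {j \<in> J. E' (f x j) = m} = card J - E x"
        using stay[OF x] fin by (simp add: card_Diff_subset)
      then show ?thesis using 2 by auto
    next
      case 3
      then have "{j \<in> J. E' (f x j) = m} = {}"
        using step[OF x] by fastforce
      then have "card {j \<in> J. E' (f x j) = m} = 0" by (simp only: card.empty)
      then show ?thesis using 3 by simp
    qed
  qed
  also have "\<dots> = m * card {x \<in> S. E x = m} + (card J + 2 - m) * card {x \<in> S. E x + 2 = m}"
    using fin by (simp add: sum.distrib sum.If_cases Int_def mult.commute)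
  finally show ?thesis .
qed

subsection \<open>Permutations\<close>

text \<open>At \<open>0\<close> the truncated \<open>i - 1\<close> is \<open>0\<close> again, so
  \<open>0\<close> is never a peak. Since \<open>n\<close> does not occur, permutations of different
  sizes are compared directly.\<close>

definition peaks :: "(nat \<Rightarrow> nat) \<Rightarrow> nat set" where
  "peaks \<pi> = {i. \<pi> (i - 1) < \<pi> i \<and> \<pi> (Suc i) < \<pi> i}"

text \<open>
  A permutation of \<open>{1..n}\<close> fixes \<open>0\<close> and \<open>n + 1\<close>, so the boundary conditions in the
  definition of exterior peaks are automatic.
\<close>

lemma exterior_peaks_eq_peaks:
  assumes "\<pi> permutes {1..n}"
  shows "exterior_peaks n \<pi> = peaks \<pi>"
proof -
  have fixed: "\<pi> i = i" if "i = 0 \<or> n < i" for i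
    using permutes_not_in[OF assms, of i] that by auto
  have range: "1 \<le> \<pi> i \<and> \<pi> i \<le> n" if "1 \<le> i" "i \<le> n" for i
    using permutes_in_image[OF assms, of i] that by auto
  have "i \<in> exterior_peaks n \<pi> \<longleftrightarrow> i \<in> peaks \<pi>" for i
  proof (cases "1 \<le> i \<and> i < n")
    case True
    then show ?thesis
      using fixed[of 0] range[of 1]
      by (cases "i = 1") (auto simp: exterior_peaks_def peaks_def numeral_2_eq_2)
  next
    case False
    then consider "i = 0" | "i = n" "0 < n" | "n < i" by linarith
    then show ?thesis
    proof cases
      case 2
      then show ?thesis using fixed[of "Suc n"] range[of n]
        by (auto simp: exterior_peaks_def peaks_def)
    next
      case 3
      then show ?thesis using fixed[of i] fixed[of "Suc i"]
        by (auto simp: exterior_peaks_def peaks_def)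
    qed (auto simp: exterior_peaks_def peaks_def)
  qed
  then show ?thesis by blast
qed

lemma peaks_subset:
  assumes "\<pi> permutes {1..n}"
  shows "peaks \<pi> \<subseteq> {1..<n}"
  unfolding exterior_peaks_eq_peaks[OF assms, symmetric] exterior_peaks_def by auto

text \<open>Of two adjacent peaks each would exceed the other. Hence \<open>peaks \<pi>\<close> and
  its shift by one are disjoint.\<close>

lemma Suc_notin_peaks: "i \<in> peaks \<pi> \<Longrightarrow> Suc i \<notin> peaks \<pi>"
  by (auto simp: peaks_def)

section \<open>Insertion of the largest letter\<close>

text \<open>The letter \<open>n + 1\<close> ends up at position \<open>j\<close>, so
  \<open>j = n + 1\<close> appends it. The last branch keeps the points beyond \<open>n + 1\<close>
  fixed, as \<open>permutes\<close> demands.\<close>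

definition insert_max :: "nat \<Rightarrow> (nat \<Rightarrow> nat) \<Rightarrow> nat \<Rightarrow> nat \<Rightarrow> nat" where
  "insert_max n \<pi> j i =
     (if i < j then \<pi> i else if i = j then Suc n else if i \<le> Suc n then \<pi> (i - 1) else i)"

lemma insert_max_permutes:
  assumes perm: "\<pi> permutes {1..n}" and j: "j \<in> {1..Suc n}"
  shows "insert_max n \<pi> j permutes {1..Suc n}"
proof (rule inj_imp_permutes)
  have range: "1 \<le> \<pi> i \<and> \<pi> i \<le> n" if "1 \<le> i" "i \<le> n" for i
    using permutes_in_image[OF perm, of i] that by auto
  have inj: "\<pi> x = \<pi> y \<longleftrightarrow> x = y" for x y
    using permutes_inj[OF perm] by (auto dest: injD)
  \<comment> \<open>The bound matters, since \<open>\<pi>\<close> fixes \<open>n + 1\<close>.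
    Position \<open>0\<close> has to be covered because \<open>x - 1\<close> below may be
    \<open>0\<close>.\<close>
  have max: "\<pi> i \<noteq> Suc n" if "i \<le> n" for i
    using range[of i] permutes_not_in[OF perm, of 0] that by (cases "i = 0") auto
  show "inj_on (insert_max n \<pi> j) {1..Suc n}"
  proof (rule inj_onI)
    fix x y assume xy: "x \<in> {1..Suc n}" "y \<in> {1..Suc n}" "insert_max n \<pi> j x = insert_max n \<pi> j y"
    have "\<pi> (x - 1) \<noteq> Suc n" "\<pi> (y - 1) \<noteq> Suc n"
      "x < j \<Longrightarrow> \<pi> x \<noteq> Suc n" "y < j \<Longrightarrow> \<pi> y \<noteq> Suc n"
      using xy(1,2) j by (auto intro!: max)
    then show "x = y"
      using xy j
      by (auto simp: insert_max_def inj split: if_splits)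
  qed
  show "insert_max n \<pi> j i \<in> {1..Suc n}" if "i \<in> {1..Suc n}" for i
  proof (cases i j rule: linorder_cases)
    case less
    then show ?thesis using range[of i] that j by (auto simp: insert_max_def)
  next
    case greater
    then have "1 \<le> \<pi> (i - 1) \<and> \<pi> (i - 1) \<le> n"
      using that j by (intro range) auto
    then show ?thesis using that greater by (auto simp: insert_max_def)
  qed (simp add: insert_max_def)
  show "insert_max n \<pi> j i = i" if "i \<notin> {1..Suc n}" for i
    using that j permutes_not_in[OF perm, of i] by (auto simp: insert_max_def)
qed simp

text \<open>The place of \<open>n + 1\<close> recovers \<open>j\<close>, and deleting that letter
  recovers \<open>\<pi>\<close>. Surjectivity follows by counting, as
  \<open>fact n * Suc n = fact (Suc n)\<close>.\<close>

lemma bij_betw_insert_max: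
  "bij_betw (\<lambda>(\<pi>, j). insert_max n \<pi> j) ({\<pi>. \<pi> permutes {1..n}} \<times> {1..Suc n})
     {\<pi>. \<pi> permutes {1..Suc n}}"
proof -
  let ?f = "\<lambda>(\<pi>, j). insert_max n \<pi> j"
  let ?D = "{\<pi>. \<pi> permutes {1..n}} \<times> {1..Suc n}"
  have inj: "inj_on ?f ?D"
  proof (rule inj_onI, clarify)
    fix \<pi> j \<rho> k
    assume perm: "\<pi> permutes {1..n}" "\<rho> permutes {1..n}"
      and jk: "j \<in> {1..Suc n}" "k \<in> {1..Suc n}"
      and eq: "insert_max n \<pi> j = insert_max n \<rho> k"
    have "insert_max n \<pi> j j = Suc n" by (simp add: insert_max_def)
    moreover have "insert_max n \<pi> j k = Suc n" unfolding eq by (simp add: insert_max_def)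
    ultimately have "j = k"
      using permutes_inj[OF insert_max_permutes[OF perm(1) jk(1)]] by (metis injD)
    moreover have "\<pi> i = \<rho> i" for i
    proof -
      consider "i < j" | "j \<le> i" "i \<le> n" | "n < i" by linarith
      then show ?thesis
      proof cases
        case 1
        then show ?thesis using fun_cong[OF eq, of i] \<open>j = k\<close> by (simp add: insert_max_def)
      next
        case 2
        then show ?thesis using fun_cong[OF eq, of "Suc i"] \<open>j = k\<close> by (simp add: insert_max_def)
      next
        case 3
        then show ?thesis using perm by (simp add: permutes_not_in)
      qed
    qed
    ultimately show "\<pi> = \<rho> \<and> j = k" by blast
  qed
  have "?f ` ?D = {\<pi>. \<pi> permutes {1..Suc n}}"
  proof (rule card_subset_eq)
    show "finite {\<pi>. \<pi> permutes {1..Suc n}}" by (rule finite_permutations) simp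
    show "?f ` ?D \<subseteq> {\<pi>. \<pi> permutes {1..Suc n}}"
      using insert_max_permutes by auto
    have "card (?f ` ?D) = fact n * Suc n"
      using card_image[OF inj] card_permutations[of "{1..n}" n] by (simp add: card_cartesian_product)
    also have "\<dots> = card {\<pi>. \<pi> permutes {1..Suc n}}"
      using card_permutations[of "{1..Suc n}" "Suc n"] by simp
    finally show "card (?f ` ?D) = card {\<pi>. \<pi> permutes {1..Suc n}}" .
  qed
  with inj show ?thesis by (simp add: bij_betw_def)
qed

text \<open>\<open>\<pi>\<close> already fixes \<open>n + 1\<close>, so appending this letter leaves
  the function, and hence its peaks, unchanged.\<close>

lemma insert_max_last:
  assumes "\<pi> permutes {1..n}"
  shows "insert_max n \<pi> (Suc n) = \<pi>"
  using permutes_not_in[OF assms] by (auto simp: insert_max_def fun_eq_iff)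

text \<open>The new maximum is a peak because \<open>j \<le> n\<close> leaves it a smaller right
  neighbour. The old positions \<open>j - 1\<close> and \<open>j\<close> become its neighbours and
  cannot be peaks; all other peaks survive, those beyond \<open>j\<close> moved by one.\<close>

lemma peaks_insert_max:
  assumes perm: "\<pi> permutes {1..n}" and j: "1 \<le> j" "j \<le> n"
  shows "peaks (insert_max n \<pi> j) =
    insert j ({i \<in> peaks \<pi>. Suc i < j} \<union> Suc ` {i \<in> peaks \<pi>. j < i})"
proof -
  have le: "\<pi> i \<le> n" if "i \<le> n" for i
    using permutes_in_image[OF perm, of i] permutes_not_in[OF perm, of i] that by fastforce
  have fixed: "\<pi> i = i" if "n < i" for i
    using permutes_not_in[OF perm, of i] that by simp
  have "i \<in> peaks (insert_max n \<pi> j) \<longleftrightarrow>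
    i = j \<or> i \<in> peaks \<pi> \<and> Suc i < j \<or> (\<exists>k. i = Suc k \<and> k \<in> peaks \<pi> \<and> j < k)" for i
  proof -
    \<comment> \<open>The cases place the window \<open>i - 1\<close>, \<open>i\<close>,
      \<open>i + 1\<close> relative to \<open>j\<close> and to the end \<open>n + 1\<close>, which
      decides the branches of \<open>insert_max\<close>.\<close>
    consider "Suc i < j" | "Suc i = j" | "i = j" | "i = Suc j" | "Suc j < i" "i \<le> n"
      | "Suc j < i" "i = Suc n" | "Suc j < i" "Suc n < i" by linarith
    then show ?thesis
    proof cases
      case 1
      then show ?thesis by (auto simp: peaks_def insert_max_def)
    next
      case 2
      then show ?thesis using le[of i] j by (auto simp: peaks_def insert_max_def)
    next
      case 3
      have "\<pi> (j - 1) \<le> n" using le[of "j - 1"] j by simp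
      then show ?thesis using 3 le[of j] j by (auto simp: peaks_def insert_max_def)
    next
      case 4
      then show ?thesis using le[of j] j by (auto simp: peaks_def insert_max_def)
    next
      case 5
      then obtain k where "i = Suc k" by (cases i) auto
      then show ?thesis using 5 by (auto simp: peaks_def insert_max_def)
    next
      \<comment> \<open>Position \<open>n + 1\<close> is followed by the fixed point
        \<open>n + 2\<close>, and the old position \<open>n\<close> by the fixed point
        \<open>n + 1\<close>; neither is a peak.\<close>
      case 6
      then show ?thesis using le[of n] fixed[of "Suc n"] j
        by (auto simp: peaks_def insert_max_def)
    next
      case 7
      then show ?thesis using peaks_subset[OF perm]
        by (auto simp: peaks_def insert_max_def)
    qed
  qed
  then show ?thesis by auto
qed

text \<open>One peak is gained at \<open>j\<close>, and old peaks at \<open>j - 1\<close> and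
  \<open>j\<close> are lost. Peaks are never adjacent, so at most one is lost; the condition says
  when this happens.\<close>

lemma card_peaks_insert_max:
  assumes perm: "\<pi> permutes {1..n}" and j: "1 \<le> j" "j \<le> n"
  shows "card (peaks (insert_max n \<pi> j)) =
    (if j \<in> peaks \<pi> \<union> Suc ` peaks \<pi> then card (peaks \<pi>) else Suc (card (peaks \<pi>)))"
proof -
  let ?P = "peaks \<pi>"
  let ?L = "{i \<in> ?P. Suc i < j}" and ?R = "{i \<in> ?P. j < i}"
  have fin: "finite ?P" using peaks_subset[OF perm] finite_subset by blast
  have "card (peaks (insert_max n \<pi> j)) = Suc (card (?L \<union> Suc ` ?R))"
    unfolding peaks_insert_max[OF assms] using fin by (subst card_insert_disjoint) auto
  also have "card (?L \<union> Suc ` ?R) = card ?L + card ?R"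
    using fin by (subst card_Un_disjoint) (auto simp: card_image)
  also have "card ?L + card ?R = card (?L \<union> ?R)"
    using fin by (subst card_Un_disjoint) auto
  also have "?L \<union> ?R = ?P - {j - 1, j}"
    using j by auto
  finally have *: "card (peaks (insert_max n \<pi> j)) = Suc (card (?P - {j - 1, j}))" .
  \<comment> \<open>Needed so that removing one peak and adding one restores the cardinality under
    truncated subtraction.\<close>
  have pos: "0 < card ?P" if "i \<in> ?P" for i
    using that fin card_gt_0_iff by blast
  consider "j \<in> ?P" "j - 1 \<notin> ?P" "j \<notin> Suc ` ?P" | "j \<notin> ?P" "j - 1 \<in> ?P" "j \<in> Suc ` ?P"
    | "j \<notin> ?P" "j - 1 \<notin> ?P" "j \<notin> Suc ` ?P"
    using j Suc_notin_peaks[of "j - 1" \<pi>] by (cases j) auto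
  then show ?thesis
  proof cases
    case 1
    then have "?P - {j - 1, j} = ?P - {j}" by blast
    then show ?thesis using 1 * pos[OF 1(1)] by simp
  next
    case 2
    then have "?P - {j - 1, j} = ?P - {j - 1}" by blast
    then show ?thesis using 2 * pos[OF 2(2)] by simp
  next
    case 3
    then have "?P - {j - 1, j} = ?P" by blast
    then show ?thesis using 3 * by simp
  qed
qed

text \<open>A peak \<open>p\<close> offers the positions \<open>p\<close> and \<open>p + 1\<close>,
  on its two sides. None is shared between peaks, and all are at most \<open>n\<close>, so the end
  \<open>n + 1\<close> is one more.\<close>

lemma card_peaks_preserving_insertions:
  assumes perm: "\<pi> permutes {1..n}"
  shows "card {j \<in> {1..Suc n}. card (peaks (insert_max n \<pi> j)) = card (peaks \<pi>)} =
    2 * card (peaks \<pi>) + 1"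
proof -
  let ?P = "peaks \<pi>"
  have fin: "finite ?P" using peaks_subset[OF perm] finite_subset by blast
  have sub: "?P \<union> Suc ` ?P \<subseteq> {1..n}" using peaks_subset[OF perm] by auto
  have "{j \<in> {1..Suc n}. card (peaks (insert_max n \<pi> j)) = card ?P}
    = insert (Suc n) (?P \<union> Suc ` ?P)" (is "?A = ?B")
  proof (rule set_eqI)
    fix j
    consider "j = Suc n" | "1 \<le> j" "j \<le> n" | "j = 0 \<or> Suc n < j" by linarith
    then show "j \<in> ?A \<longleftrightarrow> j \<in> ?B"
    proof cases
      case 1
      then show ?thesis using insert_max_last[OF perm] by simp
    next
      case 2
      then show ?thesis using card_peaks_insert_max[OF perm 2] by auto
    next
      case 3
      then show ?thesis using sub by auto
    qed
  qed
  moreover have "card ?B = Suc (card (?P \<union> Suc ` ?P))"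
    using fin sub by (subst card_insert_disjoint) auto
  moreover have "card (?P \<union> Suc ` ?P) = card ?P + card ?P"
    using fin Suc_notin_peaks by (subst card_Un_disjoint) (auto simp: card_image)
  ultimately show ?thesis by simp
qed

text \<open>Levels are measured by the odd number \<open>2 * card (peaks \<pi>) + 1\<close> so that
  the coefficients coincide with those of the recurrence for trees.\<close>

lemma card_permutations_peaks_Suc:
  "card {\<pi> \<in> {\<pi>. \<pi> permutes {1..Suc n}}. 2 * card (peaks \<pi>) + 1 = m} =
     m * card {\<pi> \<in> {\<pi>. \<pi> permutes {1..n}}. 2 * card (peaks \<pi>) + 1 = m} +
     (Suc n + 2 - m) * card {\<pi> \<in> {\<pi>. \<pi> permutes {1..n}}. 2 * card (peaks \<pi>) + 1 + 2 = m}"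
proof -
  let ?E = "\<lambda>\<pi>. 2 * card (peaks \<pi>) + 1" and ?S = "{\<pi>. \<pi> permutes {1..n}}"
  have "card {\<pi> \<in> {\<pi>. \<pi> permutes {1..Suc n}}. ?E \<pi> = m} =
     m * card {\<pi> \<in> ?S. ?E \<pi> = m} + (card {1..Suc n} + 2 - m) * card {\<pi> \<in> ?S. ?E \<pi> + 2 = m}"
  proof (rule card_level_insertion[OF _ _ bij_betw_insert_max])
    show "finite ?S" by (rule finite_permutations) simp
    show "card {j \<in> {1..Suc n}. ?E (insert_max n \<pi> j) = ?E \<pi>} = ?E \<pi>" if "\<pi> \<in> ?S" for \<pi>
      using card_peaks_preserving_insertions[of \<pi> n] that by simp
    show "?E (insert_max n \<pi> j) = ?E \<pi> \<or> ?E (insert_max n \<pi> j) = ?E \<pi> + 2"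
      if "\<pi> \<in> ?S" "j \<in> {1..Suc n}" for \<pi> j
      using that card_peaks_insert_max[of \<pi> n j] insert_max_last[of \<pi> n]
      by (cases "j = Suc n") auto
  qed simp
  then show ?thesis by (simp only: card_atLeastAtMost diff_Suc_1)
qed

subsection \<open>Increasing trees\<close>

text \<open>This amounts to choosing a smaller parent for each nonzero vertex. Arc sets are used
  instead of parent functions so that they can be the \<open>parcs\<close> of a digraph.\<close>

definition parent_arc_sets :: "nat \<Rightarrow> (nat \<times> nat) set set" where
  "parent_arc_sets n =
     {A. A \<subseteq> {(u, v). u < v \<and> v \<le> n} \<and> (\<forall>v \<in> {1..n}. \<exists>!u. (u, v) \<in> A)}"

text \<open>The range \<open>{0..n}\<close> is explicit because leaves have even degree but are the
  source of no arc.\<close>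

definition even_sources :: "nat \<Rightarrow> (nat \<times> nat) set \<Rightarrow> nat set" where
  "even_sources n A = {v \<in> {0..n}. even (card {e \<in> A. fst e = v})}"

lemma finite_parent_arc_sets: "finite (parent_arc_sets n)"
proof (rule finite_subset)
  show "parent_arc_sets n \<subseteq> Pow ({0..n} \<times> {0..n})"
    by (auto simp: parent_arc_sets_def)
qed simp

lemma finite_arcs:
  assumes "A \<in> parent_arc_sets n"
  shows "finite A"
  by (rule finite_subset[of _ "{0..n} \<times> {0..n}"])
    (use assms in \<open>auto simp: parent_arc_sets_def\<close>)

text \<open>Arcs increase, so \<open>n + 1\<close> is a leaf with a unique parent; deleting its only
  arc inverts the insertion.\<close>

lemma bij_betw_add_leaf:
  "bij_betw (\<lambda>(A, u). insert (u, Suc n) A) (parent_arc_sets n \<times> {0..n}) (parent_arc_sets (Suc n))"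
proof (rule bij_betwI')
  have new: "(u, Suc n) \<notin> A" if "A \<in> parent_arc_sets n" for A u
    using that by (auto simp: parent_arc_sets_def)
  fix x y assume xy: "x \<in> parent_arc_sets n \<times> {0..n}" "y \<in> parent_arc_sets n \<times> {0..n}"
  obtain A u where x: "x = (A, u)" by (cases x)
  obtain B w where y: "y = (B, w)" by (cases y)
  have "A = B \<and> u = w" if eq: "insert (u, Suc n) A = insert (w, Suc n) B"
  proof
    have "(u, Suc n) \<in> insert (w, Suc n) B" using eq by blast
    then show uw: "u = w" using new[of B u] xy y by auto
    show "A = B"
      using eq new[of A u] new[of B u] xy x y unfolding uw by (simp add: insert_ident)
  qed
  then show "((\<lambda>(A, u). insert (u, Suc n) A) x = (\<lambda>(A, u). insert (u, Suc n) A) y) = (x = y)"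
    by (auto simp: x y)
next
  fix x assume "x \<in> parent_arc_sets n \<times> {0..n}"
  then obtain A u where x: "x = (A, u)" "A \<in> parent_arc_sets n" "u \<le> n" by auto
  have "\<exists>!w. (w, v) \<in> insert (u, Suc n) A" if "v \<in> {1..Suc n}" for v
  proof (cases "v = Suc n")
    case True
    then show ?thesis using x by (auto simp: parent_arc_sets_def)
  next
    case False
    then have "\<exists>!w. (w, v) \<in> A" using x that by (auto simp: parent_arc_sets_def)
    then show ?thesis using False by simp
  qed
  then show "(\<lambda>(A, u). insert (u, Suc n) A) x \<in> parent_arc_sets (Suc n)"
    using x by (auto simp: parent_arc_sets_def)
next
  fix B assume B: "B \<in> parent_arc_sets (Suc n)"
  then have "\<exists>!u. (u, Suc n) \<in> B" by (simp add: parent_arc_sets_def)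
  then obtain u where u: "(u, Suc n) \<in> B" "\<And>w. (w, Suc n) \<in> B \<Longrightarrow> w = u" by blast
  let ?A = "B - {(u, Suc n)}"
  have "\<exists>!w. (w, v) \<in> ?A" if "v \<in> {1..n}" for v
  proof -
    have "\<exists>!w. (w, v) \<in> B" using B that by (auto simp: parent_arc_sets_def)
    then show ?thesis using that by auto
  qed
  moreover have "v < w \<and> w \<le> n" if "(v, w) \<in> ?A" for v w
  proof -
    have "v < w" "w \<le> Suc n" using B that by (auto simp: parent_arc_sets_def)
    moreover have "w \<noteq> Suc n" using u(2)[of v] that by auto
    ultimately show ?thesis by simp
  qed
  then have "?A \<subseteq> {(u, v). u < v \<and> v \<le> n}" by blast
  ultimately have "?A \<in> parent_arc_sets n"
    by (simp add: parent_arc_sets_def)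
  moreover have "u \<le> n" using B u(1) by (auto simp: parent_arc_sets_def)
  ultimately show "\<exists>x\<in>parent_arc_sets n \<times> {0..n}. B = (\<lambda>(A, u). insert (u, Suc n) A) x"
    using u(1) by (intro bexI[of _ "(?A, u)"]) auto
qed

text \<open>The new leaf has degree zero and joins the even vertices, while \<open>u\<close> changes
  parity; no other degree changes. The net effect is \<open>0\<close> or \<open>+2\<close>.\<close>

lemma card_even_sources_add_leaf:
  assumes A: "A \<in> parent_arc_sets n" and u: "u \<le> n"
  shows "card (even_sources (Suc n) (insert (u, Suc n) A)) =
    (if u \<in> even_sources n A then card (even_sources n A) else card (even_sources n A) + 2)"
proof -
  let ?E = "even_sources n A" and ?B = "insert (u, Suc n) A"
  have fin: "finite ?E" by (simp add: even_sources_def)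
  have new: "(u, Suc n) \<notin> A" using A by (auto simp: parent_arc_sets_def)
  have "{e \<in> ?B. fst e = Suc n} = {}"
    using A u by (auto simp: parent_arc_sets_def)
  then have leaf: "card {e \<in> ?B. fst e = Suc n} = 0" by (simp only: card.empty)
  have "{e \<in> ?B. fst e = u} = insert (u, Suc n) {e \<in> A. fst e = u}" by auto
  then have parent: "card {e \<in> ?B. fst e = u} = Suc (card {e \<in> A. fst e = u})"
    using new finite_arcs[OF A] by simp
  have other: "{e \<in> ?B. fst e = v} = {e \<in> A. fst e = v}" if "v \<noteq> u" for v
    using that by auto
  have eq: "v \<in> even_sources (Suc n) ?B \<longleftrightarrow>
      v = Suc n \<or> (if v = u then u \<notin> ?E else v \<in> ?E)" for v
  proof -
    consider "v = Suc n" | "v = u" | "v \<noteq> u" "v \<noteq> Suc n" by blast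
    then show ?thesis
    proof cases
      case 1
      then show ?thesis using leaf by (simp only: even_sources_def mem_Collect_eq) simp
    next
      case 2
      then show ?thesis using u by (simp only: even_sources_def mem_Collect_eq parent) simp
    next
      case 3
      then have "v \<in> even_sources (Suc n) ?B \<longleftrightarrow> v \<in> ?E"
        by (simp only: even_sources_def mem_Collect_eq other[OF 3(1)]) auto
      then show ?thesis using 3 by simp
    qed
  qed
  have notin: "Suc n \<notin> ?E" by (simp add: even_sources_def)
  show ?thesis
  proof (cases "u \<in> ?E")
    case True
    then have "even_sources (Suc n) ?B = insert (Suc n) (?E - {u})"
      by (intro set_eqI) (simp add: eq)
    moreover have "0 < card ?E" using True fin card_gt_0_iff by blast
    ultimately show ?thesis using True fin notin by simp
  next
    case False
    then have "even_sources (Suc n) ?B = insert (Suc n) (insert u ?E)"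
      by (intro set_eqI) (simp add: eq)
    then show ?thesis using False fin notin u by simp
  qed
qed

text \<open>The choices of parent that keep the number of even vertices are exactly the even
  vertices, so they are as many as the level itself.\<close>

lemma card_parent_arc_sets_Suc:
  "card {A \<in> parent_arc_sets (Suc n). card (even_sources (Suc n) A) = m} =
     m * card {A \<in> parent_arc_sets n. card (even_sources n A) = m} +
     (Suc n + 2 - m) * card {A \<in> parent_arc_sets n. card (even_sources n A) + 2 = m}"
proof -
  have "card {A \<in> parent_arc_sets (Suc n). card (even_sources (Suc n) A) = m} =
     m * card {A \<in> parent_arc_sets n. card (even_sources n A) = m} +
     (card {0..n} + 2 - m) * card {A \<in> parent_arc_sets n. card (even_sources n A) + 2 = m}"
  proof (rule card_level_insertion[OF finite_parent_arc_sets _ bij_betw_add_leaf])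
    fix A assume A: "A \<in> parent_arc_sets n"
    have "u \<le> n" if "u \<in> even_sources n A" for u
      using that by (simp add: even_sources_def)
    then have "{u \<in> {0..n}. card (even_sources (Suc n) (insert (u, Suc n) A)) =
        card (even_sources n A)} = even_sources n A"
      using card_even_sources_add_leaf[OF A] by (auto split: if_splits)
    then show "card {u \<in> {0..n}. card (even_sources (Suc n) (insert (u, Suc n) A)) =
        card (even_sources n A)} = card (even_sources n A)"
      by (simp only:)
  next
    fix A u assume "A \<in> parent_arc_sets n" "u \<in> {0..n}"
    then show "card (even_sources (Suc n) (insert (u, Suc n) A)) = card (even_sources n A) \<or>
        card (even_sources (Suc n) (insert (u, Suc n) A)) = card (even_sources n A) + 2"
      by (simp add: card_even_sources_add_leaf)
  qed simp
  then show ?thesis by (simp only: card_atLeastAtMost diff_zero)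
qed

section \<open>Walks from the root and the encoding of increasing trees\<close>

lemma pcas_append: "pcas u (p @ q) v \<longleftrightarrow> (\<exists>w. pcas u p w \<and> pcas w q v)"
  by (induction p arbitrary: u) auto

text \<open>The lower bound \<open>u\<close> is there to carry the induction: the first vertex must
  lie below all later ones.\<close>

lemma pcas_pawalk_verts_sorted:
  fixes A :: "(nat \<times> nat) set"
  assumes "A \<subseteq> {(u, v). u < v}" "set p \<subseteq> A" "pcas u p v"
  shows "sorted_wrt (<) (pawalk_verts u p) \<and> (\<forall>x \<in> set (pawalk_verts u p). u \<le> x)"
  using assms(2,3)
proof (induction p arbitrary: u)
  case (Cons e p)
  then have "fst e = u" "fst e < snd e" using assms(1) by auto
  moreover have "sorted_wrt (<) (pawalk_verts (snd e) p) \<and>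
      (\<forall>x \<in> set (pawalk_verts (snd e) p). snd e \<le> x)"
    using Cons by auto
  ultimately show ?case by fastforce
qed auto

text \<open>No arc enters \<open>0\<close>, so only the empty walk ends there. A walk to
  \<open>v > 0\<close> must end with the arc from the unique parent of \<open>v\<close>, which is
  smaller, so induction applies.\<close>

lemma parent_arc_sets_unique_walk:
  assumes A: "A \<in> parent_arc_sets n" and "v \<le> n"
  shows "\<exists>!p. set p \<subseteq> A \<and> pcas 0 p v"
  using assms(2)
proof (induction v rule: less_induct)
  case (less v)
  show ?case
  proof (cases "v = 0")
    case True
    have "p = []" if "set p \<subseteq> A" "pcas 0 p 0" for p
      using that A by (cases p rule: rev_exhaust) (auto simp: pcas_append parent_arc_sets_def)
    then show ?thesis using True by (intro ex1I[of _ "[]"]) auto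
  next
    case False
    then have "\<exists>!u. (u, v) \<in> A" using A less.prems by (simp add: parent_arc_sets_def)
    then obtain u where u: "(u, v) \<in> A" "\<And>w. (w, v) \<in> A \<Longrightarrow> w = u" by blast
    from u(1) A have "u < v" by (auto simp: parent_arc_sets_def)
    then have "\<exists>!p. set p \<subseteq> A \<and> pcas 0 p u" using less by simp
    then obtain p where p: "set p \<subseteq> A" "pcas 0 p u"
      "\<And>q. set q \<subseteq> A \<Longrightarrow> pcas 0 q u \<Longrightarrow> q = p"
      by blast
    show ?thesis
    proof (rule ex1I[of _ "p @ [(u, v)]"])
      show "set (p @ [(u, v)]) \<subseteq> A \<and> pcas 0 (p @ [(u, v)]) v"
        using p(1,2) u(1) by (auto simp: pcas_append)
      fix q assume q: "set q \<subseteq> A \<and> pcas 0 q v"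
      with False obtain r e where r: "q = r @ [e]" by (cases q rule: rev_exhaust) auto
      with q have "e \<in> A" "snd e = v" by (auto simp: pcas_append)
      then have "e = (u, v)" using u(2)[of "fst e"] by (cases e) auto
      with q r have "set r \<subseteq> A" "pcas 0 r u" by (auto simp: pcas_append)
      with p(3)[of r] r \<open>e = (u, v)\<close> show "q = p @ [(u, v)]" by simp
    qed
  qed
qed

lemma awalk_with_proj:
  "pre_digraph.awalk (with_proj T) u p v \<longleftrightarrow> u \<in> pverts T \<and> set p \<subseteq> parcs T \<and> pcas u p v"
  by (simp add: pre_digraph.awalk_def cas_with_proj_eq)

lemma increasing_tree_iff:
  "increasing_tree n T \<longleftrightarrow> pverts T = {0..n} \<and> parcs T \<in> parent_arc_sets n"
proof
  assume T: "increasing_tree n T"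
  then have verts: "pverts T = {0..n}" by (simp add: increasing_tree_def)
  have wf: "wf_digraph (with_proj T)"
    and uniq: "\<And>v. v \<le> n \<Longrightarrow> \<exists>!p. set p \<subseteq> parcs T \<and> pcas 0 p v"
    using T verts by (simp_all add: increasing_tree_def rooted_tree_def awalk_with_proj)
  have sorted: "sorted_wrt (<) (pawalk_verts 0 p)" if p: "set p \<subseteq> parcs T" "pcas 0 p v" "v \<le> n" for p v
  proof -
    have "pre_digraph.awalk (with_proj T) 0 p v"
      using p verts by (simp add: awalk_with_proj)
    \<comment> \<open>Sortedness is assumed for paths only. The path extracted from the walk
      \<open>p\<close> has the same ends, so uniqueness of walks identifies it with
      \<open>p\<close>.\<close>
    then have apath: "pre_digraph.apath (with_proj T) 0
        (wf_digraph.awalk_to_apath (with_proj T) p) v" (is "pre_digraph.apath _ _ ?q _")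
      by (rule wf_digraph.apath_awalk_to_apath[OF wf])
    then have "set ?q \<subseteq> parcs T \<and> pcas 0 ?q v"
      by (simp add: pre_digraph.apath_def awalk_with_proj)
    then have "?q = p" using uniq[OF p(3)] p by blast
    then show ?thesis
      using T apath by (auto simp: increasing_tree_def awalk_verts_with_proj_eq)
  qed
  have ends: "u \<le> n \<and> v \<le> n" if "(u, v) \<in> parcs T" for u v
    using wf_digraph.tail_in_verts[OF wf, of "(u, v)"] wf_digraph.head_in_verts[OF wf, of "(u, v)"]
      that verts by auto
  have arc_less: "u < v" if uv: "(u, v) \<in> parcs T" for u v
  proof -
    obtain p where p: "set p \<subseteq> parcs T" "pcas 0 p u" using uniq[of u] ends[OF uv] by blast
    \<comment> \<open>The arc is made the last step of a walk from the root, so \<open>u\<close> and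
      \<open>v\<close> are the final entries of a sorted list.\<close>
    have "sorted_wrt (<) (pawalk_verts 0 (p @ [(u, v)]))"
      using sorted[of "p @ [(u, v)]" v] p uv ends[OF uv] by (auto simp: pcas_append)
    moreover have "pawalk_verts w (p @ [(u, v)]) = map fst p @ [u, v]" for w
      by (induction p arbitrary: w) auto
    ultimately show ?thesis by (simp add: sorted_wrt_append)
  qed
  have "\<exists>!u. (u, v) \<in> parcs T" if v: "v \<in> {1..n}" for v
  proof -
    obtain p where p: "set p \<subseteq> parcs T" "pcas 0 p v" using uniq[of v] v by auto
    with v obtain r e where r: "p = r @ [e]" by (cases p rule: rev_exhaust) auto
    with p have e: "e \<in> parcs T" "snd e = v" by (auto simp: pcas_append)
    show ?thesis
    proof (rule ex1I[of _ "fst e"])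
      show "(fst e, v) \<in> parcs T" using e by (cases e) auto
      fix w assume w: "(w, v) \<in> parcs T"
      then obtain q where q: "set q \<subseteq> parcs T" "pcas 0 q w" using uniq[of w] ends by blast
      \<comment> \<open>Any parent \<open>w\<close> of \<open>v\<close> yields a walk to
        \<open>v\<close> through \<open>w\<close>. It must equal \<open>p\<close>, and the last arcs
        agree.\<close>
      then have "set (q @ [(w, v)]) \<subseteq> parcs T \<and> pcas 0 (q @ [(w, v)]) v"
        using w by (auto simp: pcas_append)
      then have "q @ [(w, v)] = p" using uniq[of v] v p by auto
      then show "w = fst e" using r by auto
    qed
  qed
  then show "pverts T = {0..n} \<and> parcs T \<in> parent_arc_sets n"
    using verts ends arc_less by (auto simp: parent_arc_sets_def)
next
  assume T: "pverts T = {0..n} \<and> parcs T \<in> parent_arc_sets n"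
  then have "wf_digraph (with_proj T)"
    by unfold_locales (auto simp: parent_arc_sets_def)
  moreover have "\<forall>v \<in> pverts T. \<exists>!p. pre_digraph.awalk (with_proj T) 0 p v"
    using T parent_arc_sets_unique_walk[of "parcs T" n] by (simp add: awalk_with_proj)
  moreover have "sorted_wrt (<) (pawalk_verts 0 p)" if "set p \<subseteq> parcs T" "pcas 0 p v" for p v
    using pcas_pawalk_verts_sorted[OF _ that] T by (fastforce simp: parent_arc_sets_def)
  ultimately show "increasing_tree n T"
    using T by (auto simp: increasing_tree_def rooted_tree_def pre_digraph.apath_def
        awalk_with_proj awalk_verts_with_proj_eq)
qed

text \<open>With the vertex set fixed as \<open>{0..n}\<close>, a tree is determined by its arcs, so
  \<open>parcs\<close> is a bijection.\<close>

lemma card_increasing_trees: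
  "card {T. increasing_tree n T \<and> card (even_degree_vertices T) = m} =
     card {A \<in> parent_arc_sets n. card (even_sources n A) = m}"
proof -
  have "even_degree_vertices T = even_sources n (parcs T)" if "pverts T = {0..n}" for T
    using that by (simp add: even_degree_vertices_def even_sources_def out_degree_def out_arcs_def)
  then have eq: "{T. increasing_tree n T \<and> card (even_degree_vertices T) = m} =
      {T. pverts T = {0..n} \<and> parcs T \<in> parent_arc_sets n \<and> card (even_sources n (parcs T)) = m}"
    by (auto simp: increasing_tree_iff)
  show ?thesis
    unfolding eq
    by (rule bij_betw_same_card[of parcs],
        rule bij_betw_byWitness[where f' = "\<lambda>A. \<lparr>pverts = {0..n}, parcs = A\<rparr>"]) auto
qed

subsection \<open>Equidistribution\<close>

text \<open>This turns the shifted level into a genuine level to which an induction hypothesis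
  applies. The case \<open>m < 2\<close> is separate because truncated \<open>m - 2\<close> would
  wrongly select level \<open>0\<close>.\<close>

lemma card_level_add_two:
  fixes s :: "'a \<Rightarrow> nat"
  shows "card {x \<in> X. s x + 2 = m} = (if m < 2 then 0 else card {x \<in> X. s x = m - 2})"
proof (cases "m < 2")
  case True
  then have "{x \<in> X. s x + 2 = m} = {}" by auto
  with True show ?thesis by (simp only: card.empty if_True)
next
  case False
  then have "s x + 2 = m \<longleftrightarrow> s x = m - 2" for x by auto
  with False show ?thesis by simp
qed

text \<open>Both counts obey one recurrence in \<open>n\<close>, linking level \<open>m\<close> to
  the levels \<open>m\<close> and \<open>m - 2\<close>, hence \<open>m\<close> is arbitrary in the
  induction. For \<open>n = 0\<close> each side has a single object, at level
  \<open>1\<close>.\<close>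

lemma card_permutations_eq_card_parent_arc_sets:
  "card {\<pi> \<in> {\<pi>. \<pi> permutes {1..n}}. 2 * card (peaks \<pi>) + 1 = m} =
     card {A \<in> parent_arc_sets n. card (even_sources n A) = m}"
proof (induction n arbitrary: m)
  case 0
  have "peaks id = {}" by (auto simp: peaks_def)
  then have perms: "{\<pi> \<in> {\<pi>. \<pi> permutes {1..0}}. 2 * card (peaks \<pi>) + 1 = m} =
      (if m = 1 then {id} else {})"
    by auto
  have "even_sources 0 {} = {0}" by (auto simp: even_sources_def)
  moreover have "parent_arc_sets 0 = {{}}" by (auto simp: parent_arc_sets_def)
  ultimately have "{A \<in> parent_arc_sets 0. card (even_sources 0 A) = m} =
      (if m = 1 then {{}} else {})"
    by auto
  with perms show ?case by (simp only:) simp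
next
  case (Suc n)
  show ?case
    by (simp only: card_permutations_peaks_Suc card_parent_arc_sets_Suc card_level_add_two Suc.IH)
qed

theorem theorem5p1:
  fixes n k :: nat
  assumes "n \<ge> 1"
  shows "card {\<pi>. \<pi> permutes {1..n} \<and> card (exterior_peaks n \<pi>) = k} =
         card {T. increasing_tree n T \<and> card (even_degree_vertices T) = 2 * k + 1}"
proof -
  have "{\<pi>. \<pi> permutes {1..n} \<and> card (exterior_peaks n \<pi>) = k} =
      {\<pi> \<in> {\<pi>. \<pi> permutes {1..n}}. 2 * card (peaks \<pi>) + 1 = 2 * k + 1}"
    using exterior_peaks_eq_peaks by auto
  then show ?thesis
    by (simp only: card_permutations_eq_card_parent_arc_sets card_increasing_trees)
qed

end
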